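(* (i) For every $\beta\in[0,1/2)$ and $C_{11}>0$ there exists a constant $C_{12}=C_{12}(\beta,C_{11})>0$ such that the following holds. Let $n\ge1$ and let $\{w_i\}_{i=1}^n$ be a set of vectors in a real linear space with a norm (or a seminorm) $\|\cdot\|$ such that $\|w_i\|=1$ for all $i$ and $$\Big\|\sum_{i=1}^n\theta_iw_i\Big\|\le C_{11}n^{\frac12+\beta}$$ for all sets of signs $\{\theta_i\}_{i=1}^n$, $\theta_i=\pm1$. Then for all sets of real coefficients $\{a_i\}_{i=1}^n$ $$\Big\|\sum_{i=1}^na_iw_i\Big\|\le C_{12}\,n^{\frac14+\frac\beta2}\Big(\sum_{i=1}^na_i^2\Big)^{1/2}.$$ (ii) This estimate cannot be improved in order: for every $\beta\in[0,1/2)$ there exist constants $C_{11}>0$ and $c>0$ such that for every $n\ge1$ there exist a real linear space with a norm $\|\cdot\|$, vectors $\{w_i\}_{i=1}^n$ in it with $\|w_i\|=1$ and $\big\|\sum_{i=1}^n\theta_iw_i\big\|\le C_{11}n^{\frac12+\beta}$ for all signs $\theta_i=\pm1$, and real coefficients $\{a_i\}_{i=1}^n$, not all zero, such that $$\Big\|\sum_{i=1}^na_iw_i\Big\|\ge c\,n^{\frac14+\frac\beta2}\Big(\sum_{i=1}^na_i^2\Big)^{1/2}.$$ *)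

theory Defs
  imports "HOL-Analysis.Analysis" "HOL-Analysis.Finite_Function_Topology"
begin

text \<open>
  A real linear space is a subspace \<open>V\<close> of a type of class \<open>real_vector\<close> (\<open>V = UNIV\<close> is allowed).
  (Semi)norms are explicit functions, so that they can be quantified over.
  Nonnegativity and \<open>p 0 = 0\<close> follow from the two seminorm laws.
\<close>

definition seminorm_on :: "'v::real_vector set \<Rightarrow> ('v \<Rightarrow> real) \<Rightarrow> bool" where
  "seminorm_on V p \<longleftrightarrow> subspace V \<and>
     (\<forall>x\<in>V. \<forall>y\<in>V. p (x + y) \<le> p x + p y) \<and>
     (\<forall>c. \<forall>x\<in>V. p (c *\<^sub>R x) = \<bar>c\<bar> * p x)"

definition norm_on :: "'v::real_vector set \<Rightarrow> ('v \<Rightarrow> real) \<Rightarrow> bool" where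
  "norm_on V p \<longleftrightarrow> seminorm_on V p \<and> (\<forall>x\<in>V. p x = 0 \<longrightarrow> x = 0)"

definition unit_system_sign_bounded ::
  "real \<Rightarrow> real \<Rightarrow> 'v::real_vector set \<Rightarrow> ('v \<Rightarrow> real) \<Rightarrow> nat \<Rightarrow> (nat \<Rightarrow> 'v) \<Rightarrow> bool" where
  "unit_system_sign_bounded \<beta> C11 V p n w \<longleftrightarrow>
     (\<forall>i\<in>{1..n}. w i \<in> V \<and> p (w i) = 1) \<and>
     (\<forall>\<theta>::nat \<Rightarrow> real. (\<forall>i\<in>{1..n}. \<theta> i = 1 \<or> \<theta> i = - 1) \<longrightarrow>
        p (\<Sum>i=1..n. \<theta> i *\<^sub>R w i) \<le> C11 * real n powr (1/2 + \<beta>))"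

text \<open>The implication of part (i) with constant \<open>C12\<close>, for all spaces inside the type \<open>'v\<close>:\<close>

definition l2_estimate :: "'v::real_vector itself \<Rightarrow> real \<Rightarrow> real \<Rightarrow> real \<Rightarrow> bool" where
  "l2_estimate _ \<beta> C11 C12 \<longleftrightarrow>
     (\<forall>n\<ge>1. \<forall>(V::'v set) p w.
        seminorm_on V p \<longrightarrow> unit_system_sign_bounded \<beta> C11 V p n w \<longrightarrow>
        (\<forall>a::nat \<Rightarrow> real. p (\<Sum>i=1..n. a i *\<^sub>R w i)
            \<le> C12 * real n powr (1/4 + \<beta>/2) * sqrt (\<Sum>i=1..n. (a i)\<^sup>2)))"

text \<open>
  The constant must not depend on the linear space, but HOL cannot quantify over types inside
  a formula: in \<open>\<exists>C12. l2_estimate TYPE('v) \<beta> C11 C12\<close> the witness could vary with \<open>'v\<close>. The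
  constant is therefore chosen once, from a fixed type (the finitely supported real sequences,
  which contain every finite-dimensional space up to isomorphism). As \<open>const_C12\<close> has no type
  parameter, a polymorphic theorem \<open>l2_estimate TYPE('v) \<beta> C11 (const_C12 \<beta> C11)\<close> says that one
  constant serves all linear spaces. Nothing is assumed here: that a suitable constant exists,
  and that it serves every \<open>'v\<close>, has to be proved.
\<close>

definition const_C12 :: "real \<Rightarrow> real \<Rightarrow> real" where
  "const_C12 \<beta> C11 = (SOME C. C > 0 \<and> l2_estimate TYPE(nat \<Rightarrow>\<^sub>0 real) \<beta> C11 C)"

end

theory Submission
  imports Defs
begin

text \<open>
  Part (i) is an interpolation argument. Put \<open>K = C11 * n powr (1/2 + \<beta>)\<close> and
  \<open>N a = p (\<Sum>i. a i *\<^sub>R w i)\<close>. Then \<open>N\<close> is at most the \<open>\<ell>\<^sup>1\<close> norm of \<open>a\<close>, because the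
  \<open>w i\<close> have norm one, and at most \<open>K\<close> times the \<open>\<ell>\<^sup>\<infinity>\<close> norm of \<open>a\<close>, because a convex function on a
  cube is bounded by its values at the vertices (\<open>seminorm_cube_le_vertices\<close>). Cutting the
  coefficients at a level \<open>t\<close> leaves a remainder of \<open>\<ell>\<^sup>1\<close> norm at most
  \<open>(\<Sum>i. (a i)\<^sup>2) / (4 * t)\<close>, and the best choice of \<open>t\<close> gives \<open>N a \<le> sqrt K * sqrt (\<Sum>i. (a i)\<^sup>2)\<close>
  (\<open>seminorm_interpolation\<close>). So \<open>sqrt C11\<close> is an admissible constant in every space. The chosen
  constant \<open>const_C12 \<beta> C11\<close>, which is only known to be admissible for finitely supported
  sequences, is admissible everywhere because the estimate concerns finitely many vectors at a
  time, and a seminorm can be pulled back along \<open>x \<mapsto> \<Sum>i. x i *\<^sub>R w i\<close>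
  (\<open>l2_estimate_transfer\<close>).

  For part (ii) the coordinate space is given the \<open>\<ell>\<^sup>1\<close> norm on the first \<open>m = \<lfloor>n powr (1/2 + \<beta>)\<rfloor>\<close>
  coordinates and the Euclidean norm on the others. All sign sums of the unit vectors have norm
  at most \<open>m + sqrt n\<close>, while the sum of the first \<open>m\<close> unit vectors has norm \<open>m = sqrt m * sqrt m\<close>,
  and \<open>sqrt m\<close> is of the order \<open>n powr (1/4 + \<beta>/2)\<close>.
\<close>

section \<open>Seminorms on a subspace\<close>

context
  fixes V :: "'v::real_vector set" and p :: "'v \<Rightarrow> real"
  assumes seminorm: "seminorm_on V p"
begin

lemma seminorm_subspace: "subspace V"
  and seminorm_triangle: "x \<in> V \<Longrightarrow> y \<in> V \<Longrightarrow> p (x + y) \<le> p x + p y"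
  and seminorm_scaleR: "x \<in> V \<Longrightarrow> p (c *\<^sub>R x) = \<bar>c\<bar> * p x"
  using seminorm by (auto simp: seminorm_on_def)

lemma seminorm_zero: "p 0 = 0"
  using seminorm_scaleR[of 0 0] subspace_0[OF seminorm_subspace] by simp

lemma seminorm_combination_in: "(\<And>i. i \<in> I \<Longrightarrow> w i \<in> V) \<Longrightarrow> (\<Sum>i\<in>I. a i *\<^sub>R w i) \<in> V"
  by (intro subspace_sum seminorm_subspace subspace_scale) auto

lemma seminorm_combination_le_l1:
  assumes "finite I" and "\<And>i. i \<in> I \<Longrightarrow> w i \<in> V" and "\<And>i. i \<in> I \<Longrightarrow> p (w i) = 1"
  shows "p (\<Sum>i\<in>I. a i *\<^sub>R w i) \<le> (\<Sum>i\<in>I. \<bar>a i\<bar>)"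
  using assms
proof (induction I rule: finite_induct)
  case empty
  then show ?case by (simp add: seminorm_zero)
next
  case (insert j I)
  have "p (a j *\<^sub>R w j + (\<Sum>i\<in>I. a i *\<^sub>R w i)) \<le> p (a j *\<^sub>R w j) + p (\<Sum>i\<in>I. a i *\<^sub>R w i)"
    using insert.prems
    by (intro seminorm_triangle seminorm_combination_in subspace_scale seminorm_subspace) auto
  moreover have "p (a j *\<^sub>R w j) = \<bar>a j\<bar>"
    using insert.prems by (simp add: seminorm_scaleR)
  ultimately show ?case
    using insert.IH insert.prems insert.hyps by simp
qed

text \<open>
  A seminorm is convex, so moving one coefficient at a time to an end of its interval \<open>[-1, 1]\<close>
  does not decrease the maximum. The summand \<open>v\<close> holds the coefficients that are already fixed.
\<close>

lemma seminorm_cube_le_vertices: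
  assumes "finite I" and "v \<in> V" and "\<And>i. i \<in> I \<Longrightarrow> w i \<in> V"
    and "\<And>i. i \<in> I \<Longrightarrow> \<bar>c i\<bar> \<le> 1"
    and "\<And>\<theta>::'i \<Rightarrow> real. (\<forall>i\<in>I. \<theta> i = 1 \<or> \<theta> i = - 1) \<Longrightarrow> p (v + (\<Sum>i\<in>I. \<theta> i *\<^sub>R w i)) \<le> K"
  shows "p (v + (\<Sum>i\<in>I. c i *\<^sub>R w i)) \<le> K"
  using assms
proof (induction I arbitrary: v rule: finite_induct)
  case empty
  then show ?case by simp
next
  case (insert j I)
  let ?S = "\<Sum>i\<in>I. c i *\<^sub>R w i"
  have wj: "w j \<in> V" using insert.prems by simp
  have S: "?S \<in> V" using insert.prems by (intro seminorm_combination_in) auto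
  have end_point: "p ((v + s *\<^sub>R w j) + ?S) \<le> K" if s: "s = 1 \<or> s = - 1" for s
  proof (rule insert.IH)
    show "v + s *\<^sub>R w j \<in> V"
      using insert.prems(1) wj seminorm_subspace by (intro subspace_add subspace_scale)
    fix \<theta> :: "'i \<Rightarrow> real"
    assume \<theta>: "\<forall>i\<in>I. \<theta> i = 1 \<or> \<theta> i = - 1"
    have "(\<Sum>i\<in>I. (\<theta>(j := s)) i *\<^sub>R w i) = (\<Sum>i\<in>I. \<theta> i *\<^sub>R w i)"
      using insert.hyps by (intro sum.cong) auto
    then have "v + (\<Sum>i\<in>insert j I. (\<theta>(j := s)) i *\<^sub>R w i)
        = (v + s *\<^sub>R w j) + (\<Sum>i\<in>I. \<theta> i *\<^sub>R w i)"
      using insert.hyps by (simp add: add.assoc)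
    moreover have "p (v + (\<Sum>i\<in>insert j I. (\<theta>(j := s)) i *\<^sub>R w i)) \<le> K"
      using \<theta> s by (intro insert.prems(4)) auto
    ultimately show "p ((v + s *\<^sub>R w j) + (\<Sum>i\<in>I. \<theta> i *\<^sub>R w i)) \<le> K"
      by (simp only:)
  qed (use insert.prems in auto)
  define l where "l = (1 + c j) / 2"
  have l: "0 \<le> l" "l \<le> 1" using insert.prems(3)[of j] by (auto simp: l_def)
  let ?x = "(v + 1 *\<^sub>R w j) + ?S" and ?y = "(v + (- 1) *\<^sub>R w j) + ?S"
  have xy: "?x \<in> V" "?y \<in> V"
    using insert.prems(1) wj S seminorm_subspace
    by (metis subspace_add subspace_scale)+
  have "v + (c j *\<^sub>R w j + ?S) = l *\<^sub>R ?x + (1 - l) *\<^sub>R ?y"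
  proof -
    have c: "c j = l - (1 - l)" by (simp add: l_def field_simps)
    show ?thesis unfolding c by (simp add: algebra_simps) (metis mult_2_right scaleR_add_left)
  qed
  then have "p (v + (c j *\<^sub>R w j + ?S)) \<le> p (l *\<^sub>R ?x) + p ((1 - l) *\<^sub>R ?y)"
    using xy seminorm_subspace
    by (simp only:) (intro seminorm_triangle subspace_scale; assumption)
  also have "\<dots> = l * p ?x + (1 - l) * p ?y"
    using l by (simp only: seminorm_scaleR[OF xy(1)] seminorm_scaleR[OF xy(2)])
  also have "\<dots> \<le> l * K + (1 - l) * K"
    using l by (intro add_mono mult_left_mono end_point) auto
  also have "\<dots> = K" by (simp add: algebra_simps)
  finally show ?case using insert.hyps by simp
qed

lemma seminorm_combination_le_linf:
  assumes I: "finite I" "\<And>i. i \<in> I \<Longrightarrow> w i \<in> V"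
    and signs: "\<And>\<theta>::'i \<Rightarrow> real. (\<forall>i\<in>I. \<theta> i = 1 \<or> \<theta> i = - 1) \<Longrightarrow> p (\<Sum>i\<in>I. \<theta> i *\<^sub>R w i) \<le> K"
    and t: "t > 0" and c: "\<And>i. i \<in> I \<Longrightarrow> \<bar>c i\<bar> \<le> t"
  shows "p (\<Sum>i\<in>I. c i *\<^sub>R w i) \<le> t * K"
proof -
  have "p (0 + (\<Sum>i\<in>I. (c i / t) *\<^sub>R w i)) \<le> K"
  proof (rule seminorm_cube_le_vertices)
    show "0 \<in> V" by (rule subspace_0[OF seminorm_subspace])
    show "\<bar>c i / t\<bar> \<le> 1" if "i \<in> I" for i
      using c[OF that] t by (simp add: abs_divide)
    show "p (0 + (\<Sum>i\<in>I. \<theta> i *\<^sub>R w i)) \<le> K"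
      if "\<forall>i\<in>I. \<theta> i = 1 \<or> \<theta> i = - 1" for \<theta> :: "'i \<Rightarrow> real"
      using signs[OF that] by simp
  qed (use I in auto)
  then have "p (\<Sum>i\<in>I. (c i / t) *\<^sub>R w i) \<le> K" by simp
  then have "t * p (\<Sum>i\<in>I. (c i / t) *\<^sub>R w i) \<le> t * K"
    using t by (intro mult_left_mono) auto
  moreover have "(\<Sum>i\<in>I. c i *\<^sub>R w i) = t *\<^sub>R (\<Sum>i\<in>I. (c i / t) *\<^sub>R w i)"
    using t by (simp add: scaleR_sum_right)
  moreover have "p (t *\<^sub>R (\<Sum>i\<in>I. (c i / t) *\<^sub>R w i)) = t * p (\<Sum>i\<in>I. (c i / t) *\<^sub>R w i)"
    using t I by (subst seminorm_scaleR) (auto intro: seminorm_combination_in)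
  ultimately show ?thesis by simp
qed

text \<open>
  Clipping the coefficients to \<open>[-t, t]\<close> splits the combination into a part controlled by the
  sign sums and a part controlled by the triangle inequality; what is clipped off a coefficient
  \<open>x\<close> has size at most \<open>\<bar>x\<bar> - t \<le> x\<^sup>2 / (4 * t)\<close>. Both parts contribute equally at the optimal
  level \<open>t\<close>.
\<close>

lemma seminorm_interpolation:
  assumes I: "finite I" "\<And>i. i \<in> I \<Longrightarrow> w i \<in> V" and unit: "\<And>i. i \<in> I \<Longrightarrow> p (w i) = 1"
    and signs: "\<And>\<theta>::'i \<Rightarrow> real. (\<forall>i\<in>I. \<theta> i = 1 \<or> \<theta> i = - 1) \<Longrightarrow> p (\<Sum>i\<in>I. \<theta> i *\<^sub>R w i) \<le> K"
    and K: "K > 0"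
  shows "p (\<Sum>i\<in>I. a i *\<^sub>R w i) \<le> sqrt K * sqrt (\<Sum>i\<in>I. (a i)\<^sup>2)"
proof (cases "\<forall>i\<in>I. a i = 0")
  case True
  then show ?thesis by (simp add: seminorm_zero)
next
  case False
  define A where "A = sqrt (\<Sum>i\<in>I. (a i)\<^sup>2)"
  have sum_pos: "(\<Sum>i\<in>I. (a i)\<^sup>2) > 0"
    using False I by (auto intro: sum_pos2)
  then have A: "A > 0" "A\<^sup>2 = (\<Sum>i\<in>I. (a i)\<^sup>2)"
    by (auto simp: A_def)
  define t where "t = A / (2 * sqrt K)"
  have t: "t > 0" using A K by (simp add: t_def)
  define c where "c = (\<lambda>i. max (- t) (min t (a i)))"
  have clipped: "p (\<Sum>i\<in>I. c i *\<^sub>R w i) \<le> t * K"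
    using t by (intro seminorm_combination_le_linf I signs) (auto simp: c_def)
  have clip_error: "\<bar>a i - c i\<bar> \<le> (a i)\<^sup>2 / (4 * t)" for i
  proof (cases "\<bar>a i\<bar> \<le> t")
    case True
    then have "c i = a i" by (auto simp: c_def)
    then show ?thesis using t by simp
  next
    case False
    then have "\<bar>a i - c i\<bar> = \<bar>a i\<bar> - t" using t by (auto simp: c_def)
    also have "\<dots> \<le> (a i)\<^sup>2 / (4 * t)"
    proof -
      have "0 \<le> (\<bar>a i\<bar> - 2 * t)\<^sup>2" by simp
      then have "(\<bar>a i\<bar> - t) * (4 * t) \<le> (a i)\<^sup>2"
        by (simp add: power2_eq_square algebra_simps)
      then show ?thesis using t by (simp add: pos_le_divide_eq)
    qed
    finally show ?thesis .
  qed
  have "p (\<Sum>i\<in>I. (a i - c i) *\<^sub>R w i) \<le> (\<Sum>i\<in>I. \<bar>a i - c i\<bar>)"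
    by (intro seminorm_combination_le_l1 I unit)
  also have "\<dots> \<le> (\<Sum>i\<in>I. (a i)\<^sup>2 / (4 * t))"
    by (intro sum_mono clip_error)
  also have "\<dots> = A\<^sup>2 / (4 * t)"
    using A by (simp add: sum_divide_distrib)
  finally have remainder: "p (\<Sum>i\<in>I. (a i - c i) *\<^sub>R w i) \<le> A\<^sup>2 / (4 * t)" .
  have "(\<Sum>i\<in>I. a i *\<^sub>R w i) = (\<Sum>i\<in>I. (a i - c i) *\<^sub>R w i) + (\<Sum>i\<in>I. c i *\<^sub>R w i)"
    by (simp add: scaleR_diff_left sum_subtractf)
  then have "p (\<Sum>i\<in>I. a i *\<^sub>R w i)
      \<le> p (\<Sum>i\<in>I. (a i - c i) *\<^sub>R w i) + p (\<Sum>i\<in>I. c i *\<^sub>R w i)"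
    using I by (simp only:) (intro seminorm_triangle seminorm_combination_in)
  also have "\<dots> \<le> A\<^sup>2 / (4 * t) + t * K"
    by (intro add_mono remainder clipped)
  also have "\<dots> = sqrt K * A"
  proof -
    have "A\<^sup>2 / (4 * t) = sqrt K * A / 2"
      using A(1) K by (simp add: t_def power2_eq_square)
    moreover have "t * K = sqrt K * A / 2"
      using K real_sqrt_mult_self[of K] by (simp add: t_def field_simps)
    ultimately show ?thesis by simp
  qed
  finally show ?thesis by (simp add: A_def)
qed

end

section \<open>The estimate with a constant common to all spaces\<close>

lemma sqrt_powr_real: "sqrt (real n powr (1/2 + \<beta>)) = real n powr (1/4 + \<beta>/2)"
proof -
  have "sqrt (real n powr (1/2 + \<beta>)) = (real n powr (1/2 + \<beta>)) powr (1/2)"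
    by (rule powr_half_sqrt[symmetric]) simp
  also have "\<dots> = real n powr ((1/2 + \<beta>) * (1/2))"
    by (rule powr_powr)
  also have "(1/2 + \<beta>) * (1/2) = 1/4 + \<beta>/2"
    by (simp add: algebra_simps)
  finally show ?thesis .
qed

lemma l2_estimate_sqrt:
  assumes "C11 > 0"
  shows "l2_estimate TYPE('v::real_vector) \<beta> C11 (sqrt C11)"
  unfolding l2_estimate_def
proof (intro allI impI)
  fix n :: nat and V :: "'v set" and p w and a :: "nat \<Rightarrow> real"
  assume n: "n \<ge> 1" and V: "seminorm_on V p" and w: "unit_system_sign_bounded \<beta> C11 V p n w"
  let ?K = "C11 * real n powr (1/2 + \<beta>)"
  have "p (\<Sum>i=1..n. a i *\<^sub>R w i) \<le> sqrt ?K * sqrt (\<Sum>i=1..n. (a i)\<^sup>2)"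
    using V w assms n by (intro seminorm_interpolation) (auto simp: unit_system_sign_bounded_def)
  also have "sqrt ?K = sqrt C11 * real n powr (1/4 + \<beta>/2)"
    by (simp add: real_sqrt_mult sqrt_powr_real)
  finally show "p (\<Sum>i=1..n. a i *\<^sub>R w i)
      \<le> sqrt C11 * real n powr (1/4 + \<beta>/2) * sqrt (\<Sum>i=1..n. (a i)\<^sup>2)" .
qed

lemma lookup_scaleR: "Poly_Mapping.lookup (c *\<^sub>R x) i = c *\<^sub>R Poly_Mapping.lookup x i"
proof -
  have "finite {i. c *\<^sub>R Poly_Mapping.lookup x i \<noteq> 0}"
    by (rule finite_subset[OF _ finite_lookup[of x]]) auto
  then show ?thesis by (simp add: scaleR_poly_mapping_def)
qed

lemma lookup_combination_single:
  "finite I \<Longrightarrow> Poly_Mapping.lookup (\<Sum>i\<in>I. a i *\<^sub>R Poly_Mapping.single i (1::real)) j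
    = (if j \<in> I then a j else 0)"
proof -
  assume I: "finite I"
  have "Poly_Mapping.lookup (\<Sum>i\<in>I. a i *\<^sub>R Poly_Mapping.single i (1::real)) j
      = (\<Sum>i\<in>I. if i = j then a i else 0)"
    unfolding lookup_sum by (intro sum.cong) (auto simp: lookup_scaleR lookup_single when_def)
  then show ?thesis using I by simp
qed

text \<open>
  For a fixed system \<open>w\<close>, the pullback of \<open>p\<close> along the linear map that sends the \<open>i\<close>-th unit
  sequence to \<open>w i\<close> is a seminorm on finitely supported sequences for which the unit sequences
  behave exactly as the \<open>w i\<close> do for \<open>p\<close>. It need not be a norm, even if \<open>p\<close> is one.
\<close>

lemma l2_estimate_transfer:
  assumes "l2_estimate TYPE(nat \<Rightarrow>\<^sub>0 real) \<beta> C11 C"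
  shows "l2_estimate TYPE('v::real_vector) \<beta> C11 C"
  unfolding l2_estimate_def
proof (intro allI impI)
  fix n :: nat and V :: "'v set" and p w and a :: "nat \<Rightarrow> real"
  assume n: "n \<ge> 1" and V: "seminorm_on V p" and w: "unit_system_sign_bounded \<beta> C11 V p n w"
  define T where "T = (\<lambda>x::nat \<Rightarrow>\<^sub>0 real. \<Sum>i=1..n. Poly_Mapping.lookup x i *\<^sub>R w i)"
  let ?e = "\<lambda>i::nat. Poly_Mapping.single i (1::real)"
  have wV: "\<And>i. i \<in> {1..n} \<Longrightarrow> w i \<in> V"
    using w by (auto simp: unit_system_sign_bounded_def)
  have T_V: "T x \<in> V" for x
    unfolding T_def by (intro seminorm_combination_in[OF V] wV)
  have T_add: "T (x + y) = T x + T y" for x y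
    by (simp add: T_def lookup_add scaleR_add_left sum.distrib)
  have T_scaleR: "T (c *\<^sub>R x) = c *\<^sub>R T x" for c x
    by (simp add: T_def lookup_scaleR scaleR_sum_right)
  have T_comb: "T (\<Sum>i=1..n. b i *\<^sub>R ?e i) = (\<Sum>i=1..n. b i *\<^sub>R w i)" for b
    by (simp add: T_def lookup_combination_single)
  have T_single: "T (?e i) = w i" if "i \<in> {1..n}" for i
  proof -
    have "T (?e i) = (\<Sum>j=1..n. if j = i then w j else 0)"
      unfolding T_def by (intro sum.cong) (auto simp: lookup_single when_def)
    then show ?thesis using that by simp
  qed
  have "seminorm_on UNIV (p \<circ> T)"
    by (simp add: seminorm_on_def T_add T_scaleR seminorm_triangle[OF V] seminorm_scaleR[OF V] T_V)
  moreover have "unit_system_sign_bounded \<beta> C11 UNIV (p \<circ> T) n ?e"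
    using w T_single unfolding unit_system_sign_bounded_def o_apply T_comb by auto
  ultimately have "(p \<circ> T) (\<Sum>i=1..n. a i *\<^sub>R ?e i)
      \<le> C * real n powr (1/4 + \<beta>/2) * sqrt (\<Sum>i=1..n. (a i)\<^sup>2)"
    using assms n unfolding l2_estimate_def by blast
  then show "p (\<Sum>i=1..n. a i *\<^sub>R w i)
      \<le> C * real n powr (1/4 + \<beta>/2) * sqrt (\<Sum>i=1..n. (a i)\<^sup>2)"
    by (simp only: o_apply T_comb)
qed

lemma const_C12_correct:
  assumes "C11 > 0"
  shows "const_C12 \<beta> C11 > 0" and "l2_estimate TYPE('v::real_vector) \<beta> C11 (const_C12 \<beta> C11)"
proof -
  have "const_C12 \<beta> C11 > 0 \<and> l2_estimate TYPE(nat \<Rightarrow>\<^sub>0 real) \<beta> C11 (const_C12 \<beta> C11)"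
    unfolding const_C12_def by (rule someI[of _ "sqrt C11"]) (simp add: assms l2_estimate_sqrt)
  then show "const_C12 \<beta> C11 > 0" and "l2_estimate TYPE('v) \<beta> C11 (const_C12 \<beta> C11)"
    by (auto intro: l2_estimate_transfer)
qed

section \<open>Sharpness\<close>

text \<open>
  By duality, sharpness asks for a functional of norm one that takes the value \<open>1\<close> on about
  \<open>n powr (1/2 + \<beta>)\<close> of the vectors, while the sign sums stay small. The sum of the first \<open>m\<close>
  coordinates is such a functional for a norm that is the \<open>\<ell>\<^sup>1\<close> norm there. The remaining vectors
  only have to be unit vectors with harmless sign sums; orthonormal ones add \<open>sqrt n\<close>, which is
  below the permitted order because \<open>\<beta> \<ge> 0\<close>.
\<close>

definition coordinate_space :: "nat \<Rightarrow> (nat \<Rightarrow>\<^sub>0 real) set" where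
  "coordinate_space n = {x. \<forall>i. i \<notin> {1..n} \<longrightarrow> Poly_Mapping.lookup x i = 0}"

definition mixed_norm :: "nat \<Rightarrow> nat \<Rightarrow> (nat \<Rightarrow>\<^sub>0 real) \<Rightarrow> real" where
  "mixed_norm m n x =
     (\<Sum>i=1..m. \<bar>Poly_Mapping.lookup x i\<bar>) + L2_set (Poly_Mapping.lookup x) {m<..n}"

lemma norm_on_mixed_norm:
  assumes "m \<le> n"
  shows "norm_on (coordinate_space n) (mixed_norm m n)"
proof -
  let ?L = "Poly_Mapping.lookup :: (nat \<Rightarrow>\<^sub>0 real) \<Rightarrow> nat \<Rightarrow> real"
  have "subspace (coordinate_space n)"
    by (auto simp: subspace_def coordinate_space_def lookup_add lookup_scaleR)
  moreover have "mixed_norm m n (x + y) \<le> mixed_norm m n x + mixed_norm m n y" for x y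
  proof -
    have "(\<Sum>i=1..m. \<bar>?L (x + y) i\<bar>) \<le> (\<Sum>i=1..m. \<bar>?L x i\<bar>) + (\<Sum>i=1..m. \<bar>?L y i\<bar>)"
      unfolding sum.distrib[symmetric] by (intro sum_mono) (simp add: lookup_add)
    moreover have "L2_set (?L (x + y)) {m<..n} \<le> L2_set (?L x) {m<..n} + L2_set (?L y) {m<..n}"
      using L2_set_triangle_ineq[of "?L x" "?L y" "{m<..n}"] by (simp add: lookup_add L2_set_def)
    ultimately show ?thesis by (simp add: mixed_norm_def)
  qed
  moreover have "mixed_norm m n (c *\<^sub>R x) = \<bar>c\<bar> * mixed_norm m n x" for c x
  proof -
    have "L2_set (?L (c *\<^sub>R x)) {m<..n} = \<bar>c\<bar> * L2_set (?L x) {m<..n}"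
      by (simp add: L2_set_def lookup_scaleR power_mult_distrib real_sqrt_mult
          flip: sum_distrib_left)
    then show ?thesis
      by (simp add: mixed_norm_def lookup_scaleR abs_mult sum_distrib_left distrib_left)
  qed
  moreover have "x = 0" if x: "x \<in> coordinate_space n" and 0: "mixed_norm m n x = 0" for x
  proof (rule poly_mapping_eqI)
    fix i
    have "(\<Sum>i=1..m. \<bar>?L x i\<bar>) \<ge> 0"
      by (intro sum_nonneg) simp
    moreover have "L2_set (?L x) {m<..n} \<ge> 0"
      by (rule L2_set_nonneg)
    ultimately have "(\<Sum>i=1..m. \<bar>?L x i\<bar>) = 0" "L2_set (?L x) {m<..n} = 0"
      using 0 unfolding mixed_norm_def by linarith+
    then have "\<forall>i\<in>{1..m}. ?L x i = 0" "\<forall>i\<in>{m<..n}. ?L x i = 0"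
      by (auto simp: sum_nonneg_eq_0_iff L2_set_eq_0_iff)
    moreover have "i \<in> {1..m} \<or> i \<in> {m<..n} \<or> i \<notin> {1..n}" by auto
    ultimately show "?L x i = ?L 0 i" using x by (auto simp: coordinate_space_def)
  qed
  ultimately show ?thesis by (simp add: norm_on_def seminorm_on_def)
qed

lemma mixed_norm_combination:
  assumes "m \<le> n"
  shows "mixed_norm m n (\<Sum>i=1..n. a i *\<^sub>R Poly_Mapping.single i 1)
    = (\<Sum>i=1..m. \<bar>a i\<bar>) + L2_set a {m<..n}"
proof -
  let ?x = "\<Sum>i=1..n. a i *\<^sub>R Poly_Mapping.single i (1::real)"
  have lookup: "Poly_Mapping.lookup ?x i = a i" if "i \<in> {1..n}" for i
    using that by (subst lookup_combination_single) auto
  have "(\<Sum>i=1..m. \<bar>Poly_Mapping.lookup ?x i\<bar>) = (\<Sum>i=1..m. \<bar>a i\<bar>)"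
    using assms lookup by (intro sum.cong) auto
  moreover have "L2_set (Poly_Mapping.lookup ?x) {m<..n} = L2_set a {m<..n}"
    using lookup by (intro L2_set_cong) auto
  ultimately show ?thesis
    unfolding mixed_norm_def by (simp only:)
qed

lemma mixed_norm_single:
  assumes "i \<in> {1..n}"
  shows "mixed_norm m n (Poly_Mapping.single i 1) = 1"
proof (cases "i \<le> m")
  case True
  have "(\<Sum>k=1..m. \<bar>Poly_Mapping.lookup (Poly_Mapping.single i (1::real)) k\<bar>)
      = (\<Sum>k=1..m. if k = i then 1 else 0)"
    by (intro sum.cong) (auto simp: lookup_single when_def)
  moreover have "L2_set (Poly_Mapping.lookup (Poly_Mapping.single i (1::real))) {m<..n} = 0"
    using True by (intro L2_set_0') (auto simp: lookup_single when_def)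
  ultimately show ?thesis using True assms by (simp add: mixed_norm_def)
next
  case False
  have "(\<Sum>k=1..m. \<bar>Poly_Mapping.lookup (Poly_Mapping.single i (1::real)) k\<bar>) = 0"
    using False by (intro sum.neutral) (auto simp: lookup_single when_def)
  moreover have "(\<Sum>k\<in>{m<..n}. (Poly_Mapping.lookup (Poly_Mapping.single i (1::real)) k)\<^sup>2)
      = (\<Sum>k\<in>{m<..n}. if k = i then 1 else 0)"
    by (intro sum.cong) (auto simp: lookup_single when_def)
  ultimately show ?thesis using False assms by (simp add: mixed_norm_def L2_set_def)
qed

text \<open>
  The restriction \<open>\<beta> < 1/2\<close> guarantees that there are \<open>m\<close> vectors to choose. Rounding down costs
  at most a factor two, since \<open>n powr (1/2 + \<beta>) < m + 1 \<le> 2 * m\<close>; a factor four is conceded to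
  have the rational constant \<open>1/2\<close> after taking the square root.
\<close>

lemma l2_estimate_sharp:
  fixes n :: nat
  assumes \<beta>: "0 \<le> \<beta>" "\<beta> < 1/2" and n: "n \<ge> 1"
  shows "\<exists>(V::(nat \<Rightarrow>\<^sub>0 real) set) p w (a::nat \<Rightarrow> real).
    norm_on V p \<and> unit_system_sign_bounded \<beta> 2 V p n w \<and>
    (\<exists>i\<in>{1..n}. a i \<noteq> 0) \<and>
    p (\<Sum>i=1..n. a i *\<^sub>R w i)
      \<ge> 1/2 * real n powr (1/4 + \<beta>/2) * sqrt (\<Sum>i=1..n. (a i)\<^sup>2)"
proof -
  let ?M = "real n powr (1/2 + \<beta>)"
  define m where "m = nat \<lfloor>?M\<rfloor>"
  have M1: "?M \<ge> 1" using n \<beta> by (intro ge_one_powr_ge_zero) auto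
  have Mn: "?M \<le> real n"
    using powr_mono[of "1/2 + \<beta>" 1 "real n"] n \<beta> by (simp only: powr_one of_nat_0_le_iff)
  have "real m = of_int \<lfloor>?M\<rfloor>"
    unfolding m_def by (rule of_nat_nat) simp
  then have mM: "real m \<le> ?M" and Mm: "?M < real m + 1"
    by linarith+
  have m1: "m \<ge> 1" using M1 Mm by linarith
  have mn: "m \<le> n" using mM Mn by linarith
  have sqrt_n: "sqrt (real n) \<le> ?M"
    unfolding powr_half_sqrt[OF of_nat_0_le_iff, symmetric]
    using n \<beta> by (intro powr_mono) auto
  let ?V = "coordinate_space n" and ?p = "mixed_norm m n"
  let ?w = "\<lambda>i::nat. Poly_Mapping.single i (1::real)"
  let ?a = "\<lambda>i::nat. if i \<le> m then 1 else 0 :: real"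
  show ?thesis
  proof (intro exI[of _ ?V] exI[of _ ?p] exI[of _ ?w] exI[of _ ?a] conjI)
    show "norm_on ?V ?p" using mn by (rule norm_on_mixed_norm)
    show "unit_system_sign_bounded \<beta> 2 ?V ?p n ?w"
      unfolding unit_system_sign_bounded_def
    proof (intro conjI ballI allI impI)
      fix i assume i: "i \<in> {1..n}"
      then show "?w i \<in> ?V" by (auto simp: coordinate_space_def lookup_single when_def)
      show "?p (?w i) = 1" using i by (rule mixed_norm_single)
    next
      fix \<theta> :: "nat \<Rightarrow> real"
      assume \<theta>: "\<forall>i\<in>{1..n}. \<theta> i = 1 \<or> \<theta> i = - 1"
      have "\<bar>\<theta> i\<bar> = 1" "(\<theta> i)\<^sup>2 = 1" if "i \<in> {1..n}" for i
        using bspec[OF \<theta> that] by auto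
      then have "(\<Sum>i=1..m. \<bar>\<theta> i\<bar>) = (\<Sum>i=1..m. 1)"
        and "(\<Sum>i\<in>{m<..n}. (\<theta> i)\<^sup>2) = (\<Sum>i\<in>{m<..n}. 1)"
        using mn by (auto intro!: sum.cong)
      then have "?p (\<Sum>i=1..n. \<theta> i *\<^sub>R ?w i) = real m + sqrt (real (n - m))"
        unfolding mixed_norm_combination[OF mn] L2_set_def by simp
      also have "\<dots> \<le> real m + sqrt (real n)" by simp
      also have "\<dots> \<le> 2 * ?M" using mM sqrt_n by simp
      finally show "?p (\<Sum>i=1..n. \<theta> i *\<^sub>R ?w i) \<le> 2 * ?M" .
    qed
    show "\<exists>i\<in>{1..n}. ?a i \<noteq> 0" using n m1 by (intro bexI[of _ 1]) auto
    have "(\<Sum>i=1..n. (?a i)\<^sup>2) = (\<Sum>i=1..m. 1)"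
      using mn by (intro sum.mono_neutral_cong_right) auto
    then have norm_a: "sqrt (\<Sum>i=1..n. (?a i)\<^sup>2) = sqrt (real m)" by simp
    have "L2_set ?a {m<..n} = 0" by (intro L2_set_0') auto
    then have p_a: "?p (\<Sum>i=1..n. ?a i *\<^sub>R ?w i) = real m"
      by (simp only: mixed_norm_combination[OF mn]) simp
    have "1/2 * real n powr (1/4 + \<beta>/2) = sqrt (?M / 4)"
      by (simp add: real_sqrt_divide sqrt_powr_real)
    also have "\<dots> \<le> sqrt (real m)"
      using Mm m1 by (intro real_sqrt_le_mono) linarith
    finally have "1/2 * real n powr (1/4 + \<beta>/2) * sqrt (real m) \<le> sqrt (real m) * sqrt (real m)"
      by (intro mult_right_mono) auto
    then show "?p (\<Sum>i=1..n. ?a i *\<^sub>R ?w i)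
        \<ge> 1/2 * real n powr (1/4 + \<beta>/2) * sqrt (\<Sum>i=1..n. (?a i)\<^sup>2)"
      unfolding p_a norm_a by simp
  qed
qed

theorem mainTheorem6:
  shows "(\<forall>\<beta> C11. 0 \<le> \<beta> \<and> \<beta> < 1/2 \<and> C11 > 0 \<longrightarrow>
            const_C12 \<beta> C11 > 0 \<and>
            l2_estimate TYPE('v::real_vector) \<beta> C11 (const_C12 \<beta> C11))
       \<and> (\<forall>\<beta>. 0 \<le> \<beta> \<and> \<beta> < 1/2 \<longrightarrow>
            (\<exists>C11>0. \<exists>c>0. \<forall>n\<ge>1.
               \<exists>(V::(nat \<Rightarrow>\<^sub>0 real) set) p w (a::nat \<Rightarrow> real).
                 norm_on V p \<and> unit_system_sign_bounded \<beta> C11 V p n w \<and>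
                 (\<exists>i\<in>{1..n}. a i \<noteq> 0) \<and>
                 p (\<Sum>i=1..n. a i *\<^sub>R w i)
                   \<ge> c * real n powr (1/4 + \<beta>/2) * sqrt (\<Sum>i=1..n. (a i)\<^sup>2)))"
proof (intro conjI allI impI)
  fix \<beta> C11 :: real
  assume "0 \<le> \<beta> \<and> \<beta> < 1/2 \<and> C11 > 0"
  then show "const_C12 \<beta> C11 > 0" and "l2_estimate TYPE('v) \<beta> C11 (const_C12 \<beta> C11)"
    by (simp_all add: const_C12_correct)
next
  fix \<beta> :: real
  assume "0 \<le> \<beta> \<and> \<beta> < 1/2"
  then have \<beta>: "0 \<le> \<beta>" "\<beta> < 1/2" by auto
  show "\<exists>C11>0. \<exists>c>0. \<forall>n\<ge>1.
     \<exists>(V::(nat \<Rightarrow>\<^sub>0 real) set) p w (a::nat \<Rightarrow> real).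
       norm_on V p \<and> unit_system_sign_bounded \<beta> C11 V p n w \<and>
       (\<exists>i\<in>{1..n}. a i \<noteq> 0) \<and>
       p (\<Sum>i=1..n. a i *\<^sub>R w i)
         \<ge> c * real n powr (1/4 + \<beta>/2) * sqrt (\<Sum>i=1..n. (a i)\<^sup>2)"
    by (rule exI[of _ 2], rule conjI, simp, rule exI[of _ "1/2"])
      (intro conjI allI impI l2_estimate_sharp[OF \<beta>]; simp)
qed

end
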